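(* Let $G$ be an infinite profinite group. For an open subgroup $H$ of $G$ put $$\mathcal{K}_H=\{K\mid K \text{ is an open normal subgroup of } G,\ K\not\le H\}.$$ Then the following are equivalent: (i) $G$ is just infinite; (ii) the set $\mathcal{K}_H$ is finite for every open subgroup $H$ of $G$; (iii) there exists a family $\mathcal{F}$ of open subgroups of $G$ with trivial intersection, such that $\mathcal{K}_H$ is a finite set for every $H\in\mathcal{F}$.
   Context: Profinite groups are treated as topological groups: all subgroups are tacitly closed, homomorphisms continuous. A profinite group $G$ is just infinite if it is infinite and every non-trivial (closed) normal subgroup of $G$ has finite index. *)

theory Defs
  imports "HOL-Analysis.Analysis" "HOL-Algebra.Coset"
begin

locale topological_group = group G for G (structure) +
  fixes T :: "'a topology"
  assumes topspace_eq_carrier: "topspace T = carrier G"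
    and continuous_mult: "continuous_map (prod_topology T T) T (\<lambda>(x, y). x \<otimes> y)"
    and continuous_inv: "continuous_map T T (\<lambda>x. inv x)"

definition totally_disconnected_space :: "'a topology \<Rightarrow> bool" where
  "totally_disconnected_space T \<longleftrightarrow> (\<forall>S. connectedin T S \<longrightarrow> (\<exists>x. S \<subseteq> {x}))"

locale profinite_group = topological_group +
  assumes compact: "compact_space T"
    and Hausdorff: "Hausdorff_space T"
    and totally_disconnected: "totally_disconnected_space T"

definition open_subgroup :: "'a set \<Rightarrow> ('a, 'b) monoid_scheme \<Rightarrow> 'a topology \<Rightarrow> bool" where
  "open_subgroup H G T \<longleftrightarrow> subgroup H G \<and> openin T H"

definition just_infinite :: "('a, 'b) monoid_scheme \<Rightarrow> 'a topology \<Rightarrow> bool" where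
  "just_infinite G T \<longleftrightarrow>
     infinite (carrier G) \<and>
     (\<forall>N. N \<lhd> G \<and> closedin T N \<and> N \<noteq> {\<one>\<^bsub>G\<^esub>} \<longrightarrow> finite (rcosets\<^bsub>G\<^esub> N))"

definition open_normal_not_below ::
    "('a, 'b) monoid_scheme \<Rightarrow> 'a topology \<Rightarrow> 'a set \<Rightarrow> 'a set set" where
  "open_normal_not_below G T H = {K. K \<lhd> G \<and> openin T K \<and> \<not> K \<subseteq> H}"

end

theory Submission
  imports Defs
begin

text \<open>
  Write \<open>\<K>\<^sub>H\<close> for the set of open normal subgroups of \<open>G\<close> that are not contained in \<open>H\<close>.

  The implication from (ii) to (iii) only needs that the open subgroups of a profinite group
  intersect trivially, and the implication from (iii) to (i) needs that every closed normal
  subgroup \<open>N\<close> is an intersection of open normal subgroups. Both follow from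
  \<open>open_normal_separation\<close>: if \<open>x\<close> is not in \<open>N\<close>, then \<open>N\<close> and \<open>x\<close> are separated by a clopen
  set \<open>U\<close>, and the elements \<open>g\<close> for which \<open>a b \<in> U \<longleftrightarrow> a g b \<in> U\<close> holds for all \<open>a\<close> and \<open>b\<close>
  form an open normal subgroup whose product with \<open>N\<close> lies in \<open>U\<close>. Given (iii) and a non-trivial
  closed normal subgroup \<open>N\<close>, choose \<open>H\<close> in the family with \<open>N\<close> not contained in \<open>H\<close>. All open
  normal subgroups above \<open>N\<close> lie in the finite set \<open>\<K>\<^sub>H\<close>, so \<open>N\<close> is a finite intersection of
  open subgroups, hence open, hence of finite index.

  The implication from (i) to (ii) rests on \<open>just_infinite_no_chain\<close>: in a just infinite group, a
  strictly descending sequence of open normal subgroups has an intersection of infinite index,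
  hence a trivial one, so by compactness its members eventually avoid any given closed set that
  does not contain the identity. For the complement of \<open>H\<close> as closed set, this says
  that \<open>\<K>\<^sub>H\<close> satisfies the descending chain condition. Suppose that \<open>\<K>\<^sub>H\<close> is infinite, and let
  \<open>N\<close> be minimal among the members of \<open>\<K>\<^sub>H\<close> that contain infinitely many members of \<open>\<K>\<^sub>H\<close>. For
  every open normal \<open>L \<subseteq> N\<close> there is \<open>K \<in> \<K>\<^sub>H\<close> with \<open>K \<subset> N\<close> and \<open>K L = N\<close>: otherwise the infinitely
  many members of \<open>\<K>\<^sub>H\<close> properly inside \<open>N\<close> would each lie in one of the finitely many proper
  subgroups \<open>K L\<close> of \<open>N\<close>, each of which contains only finitely many of them. Fix
  one \<open>K\<^sub>1 \<in> \<K>\<^sub>H\<close> properly inside \<open>N\<close> and a coset \<open>K\<^sub>1 x \<noteq> K\<^sub>1\<close> with \<open>x \<in> N\<close>. Starting with \<open>N\<close>, replace \<open>L\<close>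
  repeatedly by \<open>L \<inter> K\<close>, where \<open>K\<close> is as above for \<open>L \<inter> K\<^sub>1\<close>. This yields
  a strictly descending sequence of open normal subgroups that all meet the closed set
  \<open>K\<^sub>1 x\<close>, a contradiction.
\<close>

section \<open>Products of normal subgroups and subgroups of finite index\<close>

context group
begin

lemma cancel_left:
  assumes "x \<in> carrier G" "y \<in> carrier G"
  shows "x \<otimes> (inv x \<otimes> y) = y" "inv x \<otimes> (x \<otimes> y) = y"
  using assms by (simp_all flip: m_assoc)

lemma set_mult_memI: "h \<in> H \<Longrightarrow> k \<in> K \<Longrightarrow> h \<otimes> k \<in> H <#> K"
  by (auto simp: set_mult_def)

lemma set_mult_memE:
  assumes "x \<in> H <#> K"
  obtains h k where "h \<in> H" "k \<in> K" "x = h \<otimes> k"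
  using assms by (auto simp: set_mult_def)

lemma subset_set_mult_left:
  assumes "subgroup H G" "subgroup K G"
  shows "H \<subseteq> H <#> K"
proof
  fix x assume "x \<in> H"
  then show "x \<in> H <#> K"
    using set_mult_memI[of x H \<one> K] assms by (simp add: subgroup.one_closed subgroup.mem_carrier)
qed

lemma subset_set_mult_right:
  assumes "subgroup H G" "subgroup K G"
  shows "K \<subseteq> H <#> K"
proof
  fix x assume "x \<in> K"
  then show "x \<in> H <#> K"
    using set_mult_memI[of \<one> H x K] assms by (simp add: subgroup.one_closed subgroup.mem_carrier)
qed

lemma normal_set_mult:
  assumes "M \<lhd> G" "N \<lhd> G"
  shows "M <#> N \<lhd> G"
proof (rule normal_invI)
  interpret M: normal M G by fact
  interpret N: normal N G by fact
  show "subgroup (M <#> N) G"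
  proof (rule subgroupI)
    show "M <#> N \<subseteq> carrier G"
      by (auto elim!: set_mult_memE)
    show "M <#> N \<noteq> {}"
      using set_mult_memI[OF M.one_closed N.one_closed] by blast
  next
    fix a assume "a \<in> M <#> N"
    then obtain m n where a: "m \<in> M" "n \<in> N" "a = m \<otimes> n"
      by (rule set_mult_memE)
    have "inv a = inv m \<otimes> (m \<otimes> inv n \<otimes> inv m)"
      using a by (simp add: inv_mult_group flip: m_assoc)
    then show "inv a \<in> M <#> N"
      using a by (simp add: set_mult_memI N.inv_op_closed2)
  next
    fix a b assume "a \<in> M <#> N" "b \<in> M <#> N"
    then obtain m n m' n' where a: "m \<in> M" "n \<in> N" "a = m \<otimes> n"
      and b: "m' \<in> M" "n' \<in> N" "b = m' \<otimes> n'"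
      by (metis set_mult_memE)
    have "a \<otimes> b = (m \<otimes> m') \<otimes> ((inv m' \<otimes> n \<otimes> m') \<otimes> n')"
      using a b by (simp add: m_assoc cancel_left)
    then show "a \<otimes> b \<in> M <#> N"
      using a b by (simp add: set_mult_memI N.inv_op_closed1)
  qed
  fix x h assume x: "x \<in> carrier G" and "h \<in> M <#> N"
  then obtain m n where h: "m \<in> M" "n \<in> N" "h = m \<otimes> n"
    by (metis set_mult_memE)
  have "x \<otimes> h \<otimes> inv x = (x \<otimes> m \<otimes> inv x) \<otimes> (x \<otimes> n \<otimes> inv x)"
    using h x by (simp add: m_assoc cancel_left)
  then show "x \<otimes> h \<otimes> inv x \<in> M <#> N"
    using h x by (simp add: set_mult_memI M.inv_op_closed2 N.inv_op_closed2)
qed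

lemma set_mult_subset_subgroup:
  assumes "subgroup L G" "H \<subseteq> L" "K \<subseteq> L"
  shows "H <#> K \<subseteq> L"
  using assms by (auto elim!: set_mult_memE intro: subgroup.m_closed)

lemma r_coset_eq_preimage:
  assumes "H \<subseteq> carrier G" "a \<in> carrier G"
  shows "H #> a = {y \<in> carrier G. y \<otimes> inv a \<in> H}"
proof
  show "H #> a \<subseteq> {y \<in> carrier G. y \<otimes> inv a \<in> H}"
    using assms by (auto simp: r_coset_def m_assoc subset_iff)
  show "{y \<in> carrier G. y \<otimes> inv a \<in> H} \<subseteq> H #> a"
  proof clarify
    fix y assume y: "y \<in> carrier G" "y \<otimes> inv a \<in> H"
    then have "y = (y \<otimes> inv a) \<otimes> a"
      using assms by (simp add: m_assoc)
    then show "y \<in> H #> a"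
      using y by (auto simp: r_coset_def)
  qed
qed

lemma finite_subgroups_above:
  assumes "subgroup M G" "finite (rcosets M)"
  shows "finite {S. subgroup S G \<and> M \<subseteq> S}"
proof (rule finite_subset)
  show "finite (Union ` Pow (rcosets M))"
    using assms by simp
  show "{S. subgroup S G \<and> M \<subseteq> S} \<subseteq> Union ` Pow (rcosets M)"
  proof clarify
    fix S assume S: "subgroup S G" "M \<subseteq> S"
    have "S = \<Union>((\<lambda>a. M #> a) ` S)"
    proof
      show "S \<subseteq> \<Union>((\<lambda>a. M #> a) ` S)"
        using S assms rcos_self by (blast dest: subgroup.mem_carrier)
      show "\<Union>((\<lambda>a. M #> a) ` S) \<subseteq> S"
        using S by (auto simp: r_coset_def intro: subgroup.m_closed)
    qed
    moreover have "(\<lambda>a. M #> a) ` S \<subseteq> rcosets M"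
      using S assms by (auto intro!: rcosetsI dest: subgroup.mem_carrier)
    ultimately show "S \<in> Union ` Pow (rcosets M)"
      by blast
  qed
qed

end

section \<open>Open subgroups of topological groups\<close>

context topological_group
begin

lemma continuous_map_mult:
  assumes "continuous_map X T f" "continuous_map X T g"
  shows "continuous_map X T (\<lambda>x. f x \<otimes> g x)"
  using continuous_map_compose[OF continuous_map_pairedI[OF assms] continuous_mult]
  by (simp add: o_def)

lemma continuous_map_right_translation:
  assumes "a \<in> carrier G"
  shows "continuous_map T T (\<lambda>y. y \<otimes> a)"
  using assms by (intro continuous_map_mult) (auto simp: topspace_eq_carrier)

lemma openin_r_coset:
  assumes "openin T H" "a \<in> carrier G"
  shows "openin T (H #> a)"
proof -
  have "H \<subseteq> carrier G"
    using openin_subset[OF assms(1)] topspace_eq_carrier by simp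
  then show ?thesis
    using openin_continuous_map_preimage[OF continuous_map_right_translation[of "inv a"] assms(1)] assms(2)
    by (simp add: r_coset_eq_preimage topspace_eq_carrier)
qed

lemma openin_subgroup_mono:
  assumes "subgroup S G" "openin T K" "K \<subseteq> S" "\<one> \<in> K"
  shows "openin T S"
proof (subst openin_subopen, intro ballI)
  fix x assume x: "x \<in> S"
  then have xc: "x \<in> carrier G"
    using assms(1) by (rule subgroup.mem_carrier[rotated])
  have "x \<in> K #> x"
    using assms(4) xc by (force simp: r_coset_def)
  moreover have "K #> x \<subseteq> S"
    using assms x by (auto simp: r_coset_def intro: subgroup.m_closed)
  ultimately show "\<exists>U. openin T U \<and> x \<in> U \<and> U \<subseteq> S"
    using openin_r_coset[OF assms(2) xc] by blast
qed

lemma closedin_open_subgroup: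
  assumes "subgroup H G" "openin T H"
  shows "closedin T H"
proof -
  have "carrier G - H = \<Union>((\<lambda>a. H #> a) ` (carrier G - H))" (is "_ = ?C")
  proof
    show "carrier G - H \<subseteq> ?C"
      using assms rcos_self by blast
    show "?C \<subseteq> carrier G - H"
    proof clarify
      fix a y assume a: "a \<in> carrier G" "a \<notin> H" and "y \<in> H #> a"
      then obtain h where h: "h \<in> H" "y = h \<otimes> a"
        by (auto simp: r_coset_def)
      have hc: "h \<in> carrier G"
        using h assms by (simp add: subgroup.mem_carrier)
      have "y \<notin> H"
      proof
        assume "y \<in> H"
        then have "inv h \<otimes> y \<in> H"
          using h assms by (simp add: subgroup.m_closed subgroup.m_inv_closed)
        then show False
          using a h hc by (simp flip: m_assoc)
      qed
      then show "y \<in> carrier G - H"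
        using a h hc by simp
    qed
  qed
  moreover have "openin T ?C"
    using assms by (auto intro!: openin_Union openin_r_coset)
  ultimately have "openin T (carrier G - H)"
    by simp
  then show ?thesis
    using subgroup.subset[OF assms(1)] by (simp add: closedin_def topspace_eq_carrier)
qed

lemma finite_rcosets_open_subgroup:
  assumes "compact_space T" "subgroup H G" "openin T H"
  shows "finite (rcosets H)"
proof -
  have "\<forall>U\<in>rcosets H. openin T U"
    using assms openin_r_coset by (auto simp: RCOSETS_def)
  moreover have cover: "\<Union>(rcosets H) = topspace T"
    using rcosets_part_G[OF assms(2)] by (simp add: topspace_eq_carrier)
  ultimately obtain \<F> where \<F>: "finite \<F>" "\<F> \<subseteq> rcosets H" "topspace T \<subseteq> \<Union>\<F>"
    using assms(1) unfolding compact_space_alt by (metis order_refl)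
  have "rcosets H \<subseteq> \<F>"
  proof
    fix R assume R: "R \<in> rcosets H"
    then obtain y where y: "y \<in> R"
      using subgroup.rcosets_non_empty[OF assms(2)] by blast
    then obtain R' where R': "R' \<in> \<F>" "y \<in> R'"
      using R \<F>(3) cover by blast
    have "R = R'"
      using rcos_disjoint[OF assms(2)] R R' y \<F>(2) by (auto simp: pairwise_def disjnt_iff)
    then show "R \<in> \<F>"
      using R' by simp
  qed
  then show ?thesis
    using \<F>(1) finite_subset by blast
qed

end

section \<open>Separation by open normal subgroups\<close>

text \<open>The tube lemma in the form of a universal quantifier over a compact factor.\<close>
lemma openin_compact_forall:
  assumes "compact_space Y" "openin (prod_topology X Y) W"
  shows "openin X {x \<in> topspace X. \<forall>y\<in>topspace Y. (x, y) \<in> W}"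
proof -
  have "closedin X (fst ` (topspace (prod_topology X Y) - W))"
    using closed_map_fst[OF assms(1), of X] assms(2) unfolding closed_map_def by blast
  moreover have "{x \<in> topspace X. \<forall>y\<in>topspace Y. (x, y) \<in> W}
      = topspace X - fst ` (topspace (prod_topology X Y) - W)"
    by force
  ultimately show ?thesis
    by (metis openin_diff openin_topspace)
qed

context profinite_group
begin

lemma clopen_separation:
  assumes "closedin T N" "x \<in> carrier G" "x \<notin> N" "N \<noteq> {}"
  obtains U where "closedin T U" "openin T U" "N \<subseteq> U" "x \<notin> U"
proof -
  have "separated_between T {y} {x}" if y: "y \<in> N" for y
  proof -
    have "\<not> connected_component_of T y x"
      using totally_disconnected y assms(3)
      unfolding totally_disconnected_space_def connected_component_of_def by blast
    then have "\<not> quasi_component_of T y x"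
      using quasi_eq_connected_component_of[of T y] compact Hausdorff by simp
    moreover have "y \<in> topspace T"
      using closedin_subset[OF assms(1)] y by blast
    ultimately show ?thesis
      using assms(2) by (simp add: separated_between_singletons topspace_eq_carrier)
  qed
  moreover have "compactin T N"
    using assms(1) compact by (rule closedin_compact_space[rotated])
  ultimately have "separated_between T N {x}"
    using assms(4) by (simp add: separated_between_pointwise_left)
  then show thesis
    using that by (auto simp: separated_between)
qed

text \<open>
  The elements that can be inserted into any product of two factors without affecting
  membership in \<open>U\<close>. They form a normal subgroup, which lies inside \<open>U\<close> if \<open>U\<close> contains the
  identity and is open if \<open>U\<close> is clopen.
\<close>
definition insertion_stabilizer :: "'a set \<Rightarrow> 'a set" where
  "insertion_stabilizer U =
     {g \<in> carrier G. \<forall>a\<in>carrier G. \<forall>b\<in>carrier G. a \<otimes> b \<in> U \<longleftrightarrow> a \<otimes> g \<otimes> b \<in> U}"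

lemma insertion_stabilizer_iff:
  assumes "g \<in> insertion_stabilizer U" "a \<in> carrier G" "b \<in> carrier G"
  shows "a \<otimes> g \<otimes> b \<in> U \<longleftrightarrow> a \<otimes> b \<in> U"
  using assms by (simp add: insertion_stabilizer_def)

lemma normal_insertion_stabilizer: "insertion_stabilizer U \<lhd> G"
proof (rule normal_invI)
  show "subgroup (insertion_stabilizer U) G"
  proof (rule subgroupI)
    show "insertion_stabilizer U \<subseteq> carrier G"
      by (auto simp: insertion_stabilizer_def)
    show "insertion_stabilizer U \<noteq> {}"
      by (auto simp: insertion_stabilizer_def intro!: exI[of _ \<one>])
  next
    fix g assume g: "g \<in> insertion_stabilizer U"
    then have gc: "g \<in> carrier G"
      by (simp add: insertion_stabilizer_def)
    have "a \<otimes> b \<in> U \<longleftrightarrow> a \<otimes> inv g \<otimes> b \<in> U" if "a \<in> carrier G" "b \<in> carrier G" for a b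
      using insertion_stabilizer_iff[OF g, of "a \<otimes> inv g" b] that gc by (simp add: m_assoc)
    then show "inv g \<in> insertion_stabilizer U"
      using gc by (simp add: insertion_stabilizer_def)
  next
    fix g h assume g: "g \<in> insertion_stabilizer U" and h: "h \<in> insertion_stabilizer U"
    then have c: "g \<in> carrier G" "h \<in> carrier G"
      by (simp_all add: insertion_stabilizer_def)
    have "a \<otimes> b \<in> U \<longleftrightarrow> a \<otimes> (g \<otimes> h) \<otimes> b \<in> U" if "a \<in> carrier G" "b \<in> carrier G" for a b
      using insertion_stabilizer_iff[OF g, of a b] insertion_stabilizer_iff[OF h, of "a \<otimes> g" b] that c
      by (simp add: m_assoc)
    then show "g \<otimes> h \<in> insertion_stabilizer U"
      using c by (simp add: insertion_stabilizer_def)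
  qed
  fix x g assume x: "x \<in> carrier G" and g: "g \<in> insertion_stabilizer U"
  then have c: "g \<in> carrier G"
    by (simp add: insertion_stabilizer_def)
  have "a \<otimes> b \<in> U \<longleftrightarrow> a \<otimes> (x \<otimes> g \<otimes> inv x) \<otimes> b \<in> U" if "a \<in> carrier G" "b \<in> carrier G" for a b
  proof -
    have "a \<otimes> x \<otimes> (inv x \<otimes> b) = a \<otimes> b"
      using that x by (simp add: m_assoc cancel_left)
    then show ?thesis
      using insertion_stabilizer_iff[OF g, of "a \<otimes> x" "inv x \<otimes> b"] that c x by (simp add: m_assoc)
  qed
  then show "x \<otimes> g \<otimes> inv x \<in> insertion_stabilizer U"
    using c x by (simp add: insertion_stabilizer_def)
qed

lemma openin_insertion_stabilizer:
  assumes "closedin T U" "openin T U"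
  shows "openin T (insertion_stabilizer U)"
proof -
  let ?Y = "prod_topology T T"
  let ?X = "prod_topology T ?Y"
  let ?p = "\<lambda>z. fst (snd z) \<otimes> snd (snd z)"
  let ?q = "\<lambda>z. fst (snd z) \<otimes> fst z \<otimes> snd (snd z)"
  have proj: "continuous_map ?X T fst"
    "continuous_map ?X T (\<lambda>z. fst (snd z))" "continuous_map ?X T (\<lambda>z. snd (snd z))"
    using continuous_map_compose[OF continuous_map_snd continuous_map_fst, of T T T]
      continuous_map_compose[OF continuous_map_snd continuous_map_snd, of T T T]
    by (simp_all add: continuous_map_fst o_def)
  have p: "continuous_map ?X T ?p" and q: "continuous_map ?X T ?q"
    by (intro continuous_map_mult proj)+
  have V: "openin T (carrier G - U)"
    using assms(1) by (simp add: closedin_def topspace_eq_carrier)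
  define W where "W = {z \<in> topspace ?X. ?p z \<in> U} \<inter> {z \<in> topspace ?X. ?q z \<in> U} \<union>
    {z \<in> topspace ?X. ?p z \<in> carrier G - U} \<inter> {z \<in> topspace ?X. ?q z \<in> carrier G - U}"
  have "openin ?X W"
    unfolding W_def
    by (intro openin_Un openin_Int openin_continuous_map_preimage[OF p]
        openin_continuous_map_preimage[OF q] assms(2) V)
  moreover have "compact_space ?Y"
    using compact by (simp add: compact_space_prod_topology)
  ultimately have "openin T {g \<in> topspace T. \<forall>y\<in>topspace ?Y. (g, y) \<in> W}"
    by (rule openin_compact_forall[rotated])
  moreover have "{g \<in> topspace T. \<forall>y\<in>topspace ?Y. (g, y) \<in> W} = insertion_stabilizer U"
    by (auto simp: W_def insertion_stabilizer_def topspace_eq_carrier)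
  ultimately show ?thesis
    by simp
qed

lemma open_normal_separation:
  assumes "N \<lhd> G" "closedin T N" "x \<in> carrier G" "x \<notin> N"
  obtains K where "K \<lhd> G" "openin T K" "N \<subseteq> K" "x \<notin> K"
proof -
  interpret N: normal N G by fact
  obtain U where U: "closedin T U" "openin T U" "N \<subseteq> U" "x \<notin> U"
    using clopen_separation[OF assms(2-4)] N.one_closed by blast
  let ?S = "insertion_stabilizer U"
  have S: "subgroup ?S G"
    using normal_insertion_stabilizer normal_imp_subgroup by blast
  have K: "?S <#> N \<lhd> G"
    using normal_set_mult[OF normal_insertion_stabilizer assms(1)] .
  show thesis
  proof
    show "?S <#> N \<lhd> G"
      by (fact K)
    show "openin T (?S <#> N)"
      using openin_subgroup_mono[OF normal_imp_subgroup[OF K] openin_insertion_stabilizer[OF U(1,2)]]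
        subset_set_mult_left[OF S N.is_subgroup] subgroup.one_closed[OF S] by blast
    show "N \<subseteq> ?S <#> N"
      using subset_set_mult_right[OF S N.is_subgroup] .
    have "?S <#> N \<subseteq> U"
    proof
      fix y assume "y \<in> ?S <#> N"
      then obtain g n where g: "g \<in> ?S" and n: "n \<in> N" and y: "y = g \<otimes> n"
        by (rule set_mult_memE)
      have "g \<in> carrier G"
        using g S by (rule subgroup.mem_carrier[rotated])
      then show "y \<in> U"
        using insertion_stabilizer_iff[OF g one_closed, of n] n y U(3) by auto
    qed
    then show "x \<notin> ?S <#> N"
      using U(4) by blast
  qed
qed

lemma Inter_open_subgroups: "carrier G \<inter> \<Inter>{H. open_subgroup H G T} = {\<one>}"
proof
  show "{\<one>} \<subseteq> carrier G \<inter> \<Inter>{H. open_subgroup H G T}"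
    by (auto simp: open_subgroup_def subgroup.one_closed)
  have "x = \<one>" if x: "x \<in> carrier G" "\<And>H. open_subgroup H G T \<Longrightarrow> x \<in> H" for x
  proof (rule ccontr)
    assume "x \<noteq> \<one>"
    moreover have "closedin T {\<one>}"
      using closedin_Hausdorff_singleton[OF Hausdorff, of \<one>] by (simp add: topspace_eq_carrier)
    ultimately obtain K where "K \<lhd> G" "openin T K" "x \<notin> K"
      using open_normal_separation[OF one_is_normal _ x(1)] by auto
    then show False
      using x(2) by (auto simp: open_subgroup_def normal_imp_subgroup)
  qed
  then show "carrier G \<inter> \<Inter>{H. open_subgroup H G T} \<subseteq> {\<one>}"
    by auto
qed

section \<open>From a separating family to just infiniteness\<close>

lemma finite_rcosets_if_finite_not_below:
  assumes "finite (open_normal_not_below G T H)"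
    and N: "N \<lhd> G" "closedin T N" "\<not> N \<subseteq> H"
  shows "finite (rcosets N)"
proof -
  let ?\<K> = "{K. K \<lhd> G \<and> openin T K \<and> N \<subseteq> K}"
  have Ns: "subgroup N G"
    using N(1) by (rule normal_imp_subgroup)
  have "?\<K> \<subseteq> open_normal_not_below G T H"
    using N(3) by (auto simp: open_normal_not_below_def)
  then have fin: "finite ?\<K>"
    using assms(1) finite_subset by blast
  \<comment> \<open>This keeps the intersection below inside the carrier and the family non-empty.\<close>
  have carr: "carrier G \<in> ?\<K>"
    using subgroup.subset[OF Ns] openin_topspace[of T] normal_invI[OF subgroup_self]
    by (simp add: topspace_eq_carrier)
  have "N = \<Inter>?\<K>"
  proof
    show "\<Inter>?\<K> \<subseteq> N"
    proof
      fix x assume x: "x \<in> \<Inter>?\<K>"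
      then have "x \<in> carrier G"
        using carr by blast
      then show "x \<in> N"
        using open_normal_separation[OF N(1,2)] x by blast
    qed
  qed blast
  moreover have "openin T (\<Inter>?\<K>)"
    using fin carr by (intro openin_Inter) auto
  ultimately have "openin T N"
    by simp
  then show ?thesis
    using finite_rcosets_open_subgroup[OF compact Ns] by blast
qed

lemma just_infinite_if_separating_family:
  assumes "infinite (carrier G)" "carrier G \<inter> \<Inter>\<F> = {\<one>}"
    and "\<And>H. H \<in> \<F> \<Longrightarrow> finite (open_normal_not_below G T H)"
  shows "just_infinite G T"
  unfolding just_infinite_def
proof (intro conjI allI impI assms(1))
  fix N assume N: "N \<lhd> G \<and> closedin T N \<and> N \<noteq> {\<one>}"
  then have "\<one> \<in> N" "N \<subseteq> carrier G"
    using normal_imp_subgroup subgroup.one_closed subgroup.subset by blast+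
  then have "\<not> N \<subseteq> \<Inter>\<F>"
    using N assms(2) by blast
  then obtain H where "H \<in> \<F>" "\<not> N \<subseteq> H"
    by blast
  then show "finite (rcosets N)"
    using finite_rcosets_if_finite_not_below assms(3) N by blast
qed

section \<open>Chains in just infinite profinite groups\<close>

lemma just_infinite_no_chain:
  assumes "just_infinite G T"
    and L: "\<And>n::nat. L n \<lhd> G" "\<And>n. openin T (L n)" "\<And>n. L (Suc n) \<subset> L n"
    and C: "closedin T C" "\<one> \<notin> C" "\<And>n. L n \<inter> C \<noteq> {}"
  shows False
proof -
  have sub: "subgroup (L n) G" for n
    using L(1) by (rule normal_imp_subgroup)
  have clo: "closedin T (L n)" for n
    using closedin_open_subgroup[OF sub L(2)] .
  have dec: "decseq L"
    using L(3) by (intro decseq_SucI) blast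
  let ?M = "\<Inter>n. L n"
  have "(\<Inter>n. L n \<inter> C) \<noteq> {}"
  proof (rule compact_space_imp_nest[OF compact])
    show "closedin T (L n \<inter> C)" for n
      using clo C(1) by blast
    show "decseq (\<lambda>n. L n \<inter> C)"
      using dec by (auto simp: decseq_def)
  qed (fact C(3))
  then have nontriv: "?M \<noteq> {\<one>}"
    using C(2) by blast
  have Msub: "subgroup ?M G"
    using sub by (intro subgroups_Inter) auto
  have "?M \<lhd> G"
  proof (rule normal_invI[OF Msub])
    fix x h assume "x \<in> carrier G" "h \<in> ?M"
    then show "x \<otimes> h \<otimes> inv x \<in> ?M"
      using normal.inv_op_closed2[OF L(1)] by blast
  qed
  moreover have "closedin T ?M"
    using clo by (intro closedin_Inter) auto
  ultimately have "finite (rcosets ?M)"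
    using assms(1) nontriv unfolding just_infinite_def by blast
  then have "finite {S. subgroup S G \<and> ?M \<subseteq> S}"
    using finite_subgroups_above[OF Msub] by blast
  moreover have "range L \<subseteq> {S. subgroup S G \<and> ?M \<subseteq> S}"
    using sub by auto
  ultimately have "finite (range L)"
    by (rule finite_subset[rotated])
  moreover have "inj L"
  proof (rule linorder_injI)
    fix m n :: nat assume "m < n"
    then have "L n \<subseteq> L (Suc m)"
      using dec by (simp add: decseq_def)
    then show "L m \<noteq> L n"
      using L(3) by blast
  qed
  ultimately show False
    using finite_imageD by blast
qed

text \<open>The descending chain condition on \<open>\<K>\<^sub>H\<close>, as a minimum principle for a property \<open>P\<close>.\<close>
lemma just_infinite_minimal:
  assumes "just_infinite G T" "open_subgroup H G T"
    and "N0 \<in> open_normal_not_below G T H" "P N0"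
  obtains N where "N \<in> open_normal_not_below G T H" "P N"
    "\<And>N'. N' \<in> open_normal_not_below G T H \<Longrightarrow> N' \<subset> N \<Longrightarrow> \<not> P N'"
proof (rule ccontr)
  assume "\<not> thesis"
  with that have step: "\<exists>N'. N' \<in> open_normal_not_below G T H \<and> P N' \<and> N' \<subset> N"
    if "N \<in> open_normal_not_below G T H" "P N" for N
    using that by blast
  let ?Q = "\<lambda>(n::nat) N. N \<in> open_normal_not_below G T H \<and> P N"
  have "\<exists>L. \<forall>n. ?Q n (L n) \<and> L (Suc n) \<subset> L n"
    by (rule dependent_nat_choice[of ?Q "\<lambda>n N N'. N' \<subset> N"]) (use assms(3,4) step in blast)+
  then obtain L where "\<forall>n. ?Q n (L n) \<and> L (Suc n) \<subset> L n" ..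
  then have L: "L n \<in> open_normal_not_below G T H" "L (Suc n) \<subset> L n" for n
    by simp_all
  have H: "subgroup H G" "openin T H"
    using assms(2) by (auto simp: open_subgroup_def)
  show False
  proof (rule just_infinite_no_chain[OF assms(1), of L "carrier G - H"])
    show "closedin T (carrier G - H)"
      using H(2) closedin_topspace[of T] by (metis closedin_diff topspace_eq_carrier)
    show "\<one> \<notin> carrier G - H"
      using H(1) by (simp add: subgroup.one_closed)
    show "L n \<inter> (carrier G - H) \<noteq> {}" for n
      using L(1)[of n] subgroup.subset[OF normal_imp_subgroup, of "L n"]
      by (auto simp: open_normal_not_below_def)
  qed (use L in \<open>auto simp: open_normal_not_below_def\<close>)
qed

text \<open>
  This will be used for the set \<open>\<B>\<close> of members of \<open>\<K>\<^sub>H\<close> properly inside \<open>N\<close>. It is infinite,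
  each member contains only finitely many others, and it is closed under passing to larger
  normal subgroups that are still properly inside \<open>N\<close>. Only finitely many subgroups contain the
  open normal subgroup \<open>L\<close>, so not all of the products \<open>K L\<close> with \<open>K \<in> \<B>\<close> can be proper in \<open>N\<close>.
\<close>
lemma open_normal_supplement:
  assumes N: "subgroup N G" and L: "L \<lhd> G" "openin T L" "L \<subseteq> N"
    and \<B>: "infinite \<B>" "\<And>K. K \<in> \<B> \<Longrightarrow> K \<lhd> G \<and> K \<subseteq> N"
    and up: "\<And>K K'. K \<in> \<B> \<Longrightarrow> K' \<lhd> G \<Longrightarrow> K \<subseteq> K' \<Longrightarrow> K' \<subset> N \<Longrightarrow> K' \<in> \<B>"
    and down: "\<And>K. K \<in> \<B> \<Longrightarrow> finite {K' \<in> \<B>. K' \<subseteq> K}"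
  shows "\<exists>K\<in>\<B>. K <#> L = N"
proof (rule ccontr)
  assume no: "\<not> ?thesis"
  have Ls: "subgroup L G"
    using L(1) by (rule normal_imp_subgroup)
  let ?\<P> = "(\<lambda>K. K <#> L) ` \<B>"
  have \<P>: "P \<in> \<B> \<and> subgroup P G \<and> L \<subseteq> P" if P: "P \<in> ?\<P>" for P
  proof -
    obtain K where K: "K \<in> \<B>" "P = K <#> L"
      using P by blast
    have Kn: "K \<lhd> G" "K \<subseteq> N"
      using \<B>(2)[OF K(1)] by auto
    have Ks: "subgroup K G"
      using Kn(1) by (rule normal_imp_subgroup)
    have Pn: "P \<lhd> G"
      using K(2) normal_set_mult[OF Kn(1) L(1)] by simp
    have "P \<subset> N"
      using no K set_mult_subset_subgroup[OF N Kn(2) L(3)] by blast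
    then show ?thesis
      using up[OF K(1) Pn] subset_set_mult_left[OF Ks Ls] subset_set_mult_right[OF Ks Ls] K(2)
        normal_imp_subgroup[OF Pn] by blast
  qed
  have "finite ?\<P>"
  proof (rule finite_subset)
    show "?\<P> \<subseteq> {S. subgroup S G \<and> L \<subseteq> S}"
      using \<P> by blast
    show "finite {S. subgroup S G \<and> L \<subseteq> S}"
      using finite_subgroups_above[OF Ls finite_rcosets_open_subgroup[OF compact Ls L(2)]] .
  qed
  then have "finite (\<Union>P\<in>?\<P>. {K' \<in> \<B>. K' \<subseteq> P})"
    using \<P> down by blast
  moreover have "\<B> \<subseteq> (\<Union>P\<in>?\<P>. {K' \<in> \<B>. K' \<subseteq> P})"
  proof
    fix K assume K: "K \<in> \<B>"
    have "K \<subseteq> K <#> L"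
      using subset_set_mult_left[OF normal_imp_subgroup Ls] \<B>(2)[OF K] by blast
    then show "K \<in> (\<Union>P\<in>?\<P>. {K' \<in> \<B>. K' \<subseteq> P})"
      using K by blast
  qed
  ultimately show False
    using \<B>(1) finite_subset by blast
qed

lemma just_infinite_imp_finite_not_below:
  assumes ji: "just_infinite G T" and H: "open_subgroup H G T"
  shows "finite (open_normal_not_below G T H)" (is "finite ?\<K>")
proof (rule ccontr)
  assume inf: "infinite ?\<K>"
  let ?P = "\<lambda>N. infinite {K \<in> ?\<K>. K \<subseteq> N}"
  have \<K>D: "K \<lhd> G" "openin T K" "subgroup K G" if "K \<in> ?\<K>" for K
    using that by (auto simp: open_normal_not_below_def normal_imp_subgroup)
  have "\<exists>N0. N0 \<in> ?\<K> \<and> ?P N0"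
  proof (intro exI conjI)
    have top: "K \<subseteq> carrier G" if "K \<in> ?\<K>" for K
      using \<K>D(3)[OF that] by (rule subgroup.subset)
    then have "{K \<in> ?\<K>. K \<subseteq> carrier G} = ?\<K>"
      by blast
    then show "?P (carrier G)"
      using inf by simp
    obtain K where "K \<in> ?\<K>"
      using inf by fastforce
    then show "carrier G \<in> ?\<K>"
      using top openin_topspace[of T] normal_invI[OF subgroup_self]
      by (auto simp: open_normal_not_below_def topspace_eq_carrier)
  qed
  then obtain N0 where N0: "N0 \<in> ?\<K>" "?P N0"
    by blast
  obtain N where N: "N \<in> ?\<K>" "?P N"
    and min: "\<And>N'. N' \<in> ?\<K> \<Longrightarrow> N' \<subset> N \<Longrightarrow> \<not> ?P N'"
    by (rule just_infinite_minimal[where P = ?P, OF ji H N0]) (rule that)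
  note Nn = \<K>D[OF N(1)]
  define \<B> where "\<B> = {K \<in> ?\<K>. K \<subset> N}"
  have "{K \<in> ?\<K>. K \<subseteq> N} \<subseteq> insert N \<B>"
    by (auto simp: \<B>_def)
  then have inf\<B>: "infinite \<B>"
    using N(2) finite_subset by blast
  have supp: "\<exists>K\<in>\<B>. K <#> L = N" if "L \<lhd> G" "openin T L" "L \<subseteq> N" for L
  proof (rule open_normal_supplement[OF Nn(3) that inf\<B>])
    show "K \<lhd> G \<and> K \<subseteq> N" if "K \<in> \<B>" for K
      using that \<K>D by (auto simp: \<B>_def)
    show "K' \<in> \<B>" if K: "K \<in> \<B>" "K' \<lhd> G" "K \<subseteq> K'" "K' \<subset> N" for K K'
    proof -
      have "K \<in> ?\<K>"
        using K(1) by (simp add: \<B>_def)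
      then have "openin T K'"
        using openin_subgroup_mono[OF normal_imp_subgroup[OF K(2)] _ K(3)] \<K>D
          subgroup.one_closed by blast
      then show ?thesis
        using K by (auto simp: \<B>_def open_normal_not_below_def)
    qed
    show "finite {K' \<in> \<B>. K' \<subseteq> K}" if "K \<in> \<B>" for K
      using that by (intro finite_subset[OF _ min[of K, simplified]]) (auto simp: \<B>_def)
  qed
  obtain K1 where "K1 \<in> \<B>"
    using inf\<B> by fastforce
  then have K1: "K1 \<in> ?\<K>" "K1 \<subset> N"
    by (auto simp: \<B>_def)
  note K1n = \<K>D[OF K1(1)]
  obtain x where x: "x \<in> N" "x \<notin> K1"
    using K1(2) by blast
  have xc: "x \<in> carrier G"
    using x(1) Nn(3) by (rule subgroup.mem_carrier[rotated])
  \<comment> \<open>This is the coset of \<open>x\<close> modulo \<open>K1\<close>.\<close>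
  define C where "C = {y \<in> topspace T. y \<otimes> inv x \<in> K1}"
  have C: "closedin T C"
    unfolding C_def
    using closedin_continuous_map_preimage[OF continuous_map_right_translation
        closedin_open_subgroup[OF K1n(3,2)]] xc by blast
  have oneC: "\<one> \<notin> C"
  proof
    assume "\<one> \<in> C"
    then have "inv x \<in> K1"
      using xc by (simp add: C_def)
    then show False
      using x(2) xc subgroup.m_inv_closed[OF K1n(3)] by fastforce
  qed
  let ?Q = "\<lambda>(n::nat) L. L \<lhd> G \<and> openin T L \<and> L \<subseteq> N \<and> L \<inter> C \<noteq> {}"
  have "\<exists>L. \<forall>n. ?Q n (L n) \<and> L (Suc n) \<subset> L n"
  proof (rule dependent_nat_choice[of ?Q "\<lambda>n L L'. L' \<subset> L"])
    have "x \<in> C"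
      using xc subgroup.one_closed[OF K1n(3)] by (simp add: C_def topspace_eq_carrier)
    then show "\<exists>L. ?Q 0 L"
      using Nn x(1) by blast
  next
    fix L and n :: nat assume L: "?Q n L"
    then have Ls: "subgroup L G"
      using normal_imp_subgroup by blast
    have "L \<inter> K1 \<lhd> G" "openin T (L \<inter> K1)" "L \<inter> K1 \<subseteq> N"
      using L K1n normal_subgroup_intersect by auto
    then obtain K where "K \<in> \<B>" and KL: "K <#> (L \<inter> K1) = N"
      using supp by blast
    then have K: "K \<in> ?\<K>" "K \<subset> N"
      by (auto simp: \<B>_def)
    note Kn = \<K>D[OF K(1)]
    obtain y where y: "y \<in> L" "y \<in> C"
      using L by blast
    have "y \<in> K <#> (L \<inter> K1)"
      using y(1) L KL by blast
    then obtain k l where k: "k \<in> K" and l: "l \<in> L" "l \<in> K1" and ykl: "y = k \<otimes> l"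
      by (metis IntE set_mult_memE)
    have c: "k \<in> carrier G" "l \<in> carrier G"
      using k l Kn(3) Ls by (auto intro: subgroup.mem_carrier)
    \<comment> \<open>Modulo \<open>K1\<close> the element \<open>k\<close> of \<open>L \<inter> K\<close> agrees with \<open>y\<close>, so it lies in the coset \<open>C\<close> as well.\<close>
    have "k = y \<otimes> inv l"
      using c ykl by (simp add: m_assoc)
    then have kL: "k \<in> L"
      using y(1) l(1) Ls by (simp add: subgroup.m_closed subgroup.m_inv_closed)
    have "k \<otimes> inv x = (y \<otimes> inv x) \<otimes> (x \<otimes> inv l \<otimes> inv x)"
      using c xc ykl by (simp add: m_assoc cancel_left)
    moreover have "x \<otimes> inv l \<otimes> inv x \<in> K1"
      using normal.inv_op_closed2[OF K1n(1) xc] subgroup.m_inv_closed[OF K1n(3) l(2)] by blast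
    ultimately have "k \<otimes> inv x \<in> K1"
      using y(2) subgroup.m_closed[OF K1n(3)] by (simp add: C_def)
    then have kC: "k \<in> C"
      using c(1) by (simp add: C_def topspace_eq_carrier)
    \<comment> \<open>The inclusion would give \<open>N = K (L \<inter> K1) \<subseteq> K\<close>.\<close>
    have "\<not> L \<subseteq> K"
    proof
      assume "L \<subseteq> K"
      then have "K <#> (L \<inter> K1) \<subseteq> K"
        using set_mult_subset_subgroup[OF Kn(3)] by blast
      then show False
        using KL K(2) by blast
    qed
    then have "L \<inter> K \<subset> L"
      by blast
    moreover have "?Q (Suc n) (L \<inter> K)"
      using L Kn normal_subgroup_intersect kL k kC by blast
    ultimately show "\<exists>L'. ?Q (Suc n) L' \<and> L' \<subset> L"
      by blast
  qed
  then obtain L where "\<forall>n. ?Q n (L n) \<and> L (Suc n) \<subset> L n" ..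
  then show False
    using just_infinite_no_chain[OF ji, of L C] C oneC by simp
qed

end

section \<open>The equivalence\<close>

theorem theoremA:
  fixes G :: "('a, 'b) monoid_scheme" and T :: "'a topology"
  assumes "profinite_group G T" and "infinite (carrier G)"
  shows "(just_infinite G T \<longleftrightarrow>
            (\<forall>H. open_subgroup H G T \<longrightarrow> finite (open_normal_not_below G T H))) \<and>
         ((\<forall>H. open_subgroup H G T \<longrightarrow> finite (open_normal_not_below G T H)) \<longleftrightarrow>
            (\<exists>\<F>. (\<forall>H\<in>\<F>. open_subgroup H G T) \<and> carrier G \<inter> \<Inter>\<F> = {\<one>\<^bsub>G\<^esub>} \<and>
                 (\<forall>H\<in>\<F>. finite (open_normal_not_below G T H))))"
    (is "(?i \<longleftrightarrow> ?ii) \<and> (?ii \<longleftrightarrow> ?iii)")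
proof -
  interpret profinite_group G T by fact
  have "?i \<Longrightarrow> ?ii"
    using just_infinite_imp_finite_not_below by blast
  moreover have "?ii \<Longrightarrow> ?iii"
    using Inter_open_subgroups by (intro exI[of _ "{H. open_subgroup H G T}"]) simp
  moreover have "?iii \<Longrightarrow> ?i"
    using just_infinite_if_separating_family[OF assms(2)] by blast
  ultimately show ?thesis
    by blast
qed

end
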